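(* ($N=6$.) Let $Z_{AB}=-Z_{BA}$, $A,B=1,\dots,6$, and $X$ be complex variables, and for complex antisymmetric $\xi_{AB}$ (with $\xi^{AB}:=\overline{\xi_{AB}}$) let $$\delta Z_{AB}=\tfrac14\,\epsilon_{ABCDEF}\,\xi^{CD}\bar Z^{EF}+\xi_{AB}\bar X,\qquad \delta X=\tfrac12\,\xi_{AB}\bar Z^{AB}.$$ With $A_A{}^B=Z_{AC}\bar Z^{CB}$ put $$I_1=(\mathrm{Tr}A)^2,\quad I_2=\mathrm{Tr}(A^2),\quad I_3=\frac1{2^3\,3!}\,\mathrm{Re}\!\left(\epsilon^{ABCDEF}Z_{AB}Z_{CD}Z_{EF}\,X\right),\quad I_4=(\mathrm{Tr}A)\,X\bar X,\quad I_5=X^2\bar X^2 .$$ Then $$S^2=\tfrac14\left(4I_2-I_1+32I_3+4I_4+4I_5\right)$$ satisfies $\delta(S^2)=0$ for all $\xi$, and every linear combination of $I_1,\dots,I_5$ with constant coefficients that is invariant under all these transformations is a constant multiple of $S^2$.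
   Context: In $D=4$, $N=6$ supergravity the scalar manifold is $O^*(12)/U(6)$; the charges form the spinor $32\to(15,1)+(\overline{15},-1)+(1,-3)+(1,3)$ of $O^*(12)$ decomposed under $U(6)$, with $Z_{AB}$ the central charges and $X$ the $SU(6)$-singlet charge. The displayed $\delta$ are the infinitesimal $O^*(12)$ transformations in the coset directions; $I_1,\dots,I_5$ are the quartic $U(6)$ invariants. $\bar Z^{AB}=(Z_{AB})^*$, $\mathrm{Tr}A=Z_{AB}\bar Z^{BA}$ (so $\mathrm{Tr}A\le0$), $\mathrm{Tr}(A^2)=Z_{AB}\bar Z^{BC}Z_{CD}\bar Z^{DA}$; $\epsilon$ is the totally antisymmetric symbol with $\epsilon_{123456}=\epsilon^{123456}=1$; repeated indices are summed over $1,\dots,6$; $\delta$ acts as a derivation commuting with complex conjugation. *)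

theory Defs
  imports "HOL-Analysis.Analysis"
begin

text \<open>
  Index values \<open>A, B, \<dots>\<close> are the elements of the six-element type \<open>6\<close>, written
  \<open>1, \<dots>, 6\<close>. Arithmetic there is modulo six, so \<open>6 = 0\<close>; the numerals
  \<open>1, \<dots>, 6\<close> are still pairwise distinct and exhaust the type.
\<close>

definition skew :: "complex^6^6 \<Rightarrow> bool" where
  "skew Z \<longleftrightarrow> (\<forall>a b. Z $ a $ b = - Z $ b $ a)"

definition conj_mat :: "complex^6^6 \<Rightarrow> complex^6^6" where
  "conj_mat Z = (\<chi> a b. cnj (Z $ a $ b))"

definition eps :: "6 \<Rightarrow> 6 \<Rightarrow> 6 \<Rightarrow> 6 \<Rightarrow> 6 \<Rightarrow> 6 \<Rightarrow> complex" where
  "eps a b c d e f =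
     (let p = id(1 := a, 2 := b, 3 := c, 4 := d, 5 := e, 6 := f)
      in if bij p then of_int (sign p) else 0)"

lemma eps_123456: "eps 1 2 3 4 5 6 = 1"
proof -
  have "id(1 := 1, 2 := 2, 3 := 3, 4 := 4, 5 := 5, 6 := 6) = (id :: 6 \<Rightarrow> 6)"
    by (simp add: fun_eq_iff)
  then show ?thesis
    by (simp only: eps_def Let_def) (simp add: sign_id)
qed

lemma distinct_indices: "distinct [1, 2, 3, 4, 5, 6 :: 6]"
  by simp

type_synonym charges = "(complex^6^6) \<times> complex"

definition delta_Z :: "complex^6^6 \<Rightarrow> charges \<Rightarrow> complex^6^6" where
  "delta_Z \<xi> = (\<lambda>(Z, X). \<chi> a b.
     1/4 * (\<Sum>c\<in>UNIV. \<Sum>d\<in>UNIV. \<Sum>e\<in>UNIV. \<Sum>f\<in>UNIV.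
              eps a b c d e f * conj_mat \<xi> $ c $ d * conj_mat Z $ e $ f)
     + \<xi> $ a $ b * cnj X)"

definition delta_X :: "complex^6^6 \<Rightarrow> charges \<Rightarrow> complex" where
  "delta_X \<xi> = (\<lambda>(Z, X). 1/2 * (\<Sum>a\<in>UNIV. \<Sum>b\<in>UNIV. \<xi> $ a $ b * conj_mat Z $ a $ b))"

text \<open>
  The variation \<open>\<delta>F\<close> of a function of the charges and their complex conjugates is its
  real directional derivative along the vector field \<open>(\<delta>Z, \<delta>X)\<close>. It is used at
  antisymmetric \<open>Z\<close>, where this field is tangent to the space of antisymmetric matrices.
  The lemmas below confirm that this is the derivation commuting with complex
  conjugation that takes the prescribed values on the coordinates.
\<close>

definition delta :: "complex^6^6 \<Rightarrow> (charges \<Rightarrow> complex) \<Rightarrow> charges \<Rightarrow> complex" where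
  "delta \<xi> F p = frechet_derivative F (at p) (delta_Z \<xi> p, delta_X \<xi> p)"

lemma delta_eqI:
  assumes "(F has_derivative D) (at p)"
  shows "delta \<xi> F p = D (delta_Z \<xi> p, delta_X \<xi> p)"
  using frechet_derivative_at[OF assms] by (simp add: delta_def)

lemma delta_coord_Z: "delta \<xi> (\<lambda>p. fst p $ a $ b) p = delta_Z \<xi> p $ a $ b"
proof -
  have "bounded_linear (\<lambda>p::charges. fst p $ a $ b)"
    by (intro bounded_linear_compose[OF bounded_linear_vec_nth]
          bounded_linear_vec_nth bounded_linear_fst)
  from delta_eqI[OF bounded_linear_imp_has_derivative[OF this]] show ?thesis by simp
qed

lemma delta_coord_X: "delta \<xi> snd p = delta_X \<xi> p"
  by (subst delta_eqI[OF bounded_linear_imp_has_derivative[OF bounded_linear_snd]]) simp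

lemma delta_const: "delta \<xi> (\<lambda>p. c) p = 0"
  by (subst delta_eqI[OF has_derivative_const]) simp

lemma delta_add:
  assumes "F differentiable (at p)" "G differentiable (at p)"
  shows "delta \<xi> (\<lambda>p. F p + G p) p = delta \<xi> F p + delta \<xi> G p"
  using delta_eqI[OF has_derivative_add[OF assms[unfolded frechet_derivative_works]]]
  by (simp add: delta_def)

lemma delta_mult:
  assumes "F differentiable (at p)" "G differentiable (at p)"
  shows "delta \<xi> (\<lambda>p. F p * G p) p = F p * delta \<xi> G p + delta \<xi> F p * G p"
  using delta_eqI[OF has_derivative_mult[OF assms[unfolded frechet_derivative_works]]]
  by (simp add: delta_def)

lemma delta_cnj:
  assumes "F differentiable (at p)"
  shows "delta \<xi> (\<lambda>p. cnj (F p)) p = cnj (delta \<xi> F p)"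
  using delta_eqI[OF has_derivative_cnj[OF assms[unfolded frechet_derivative_works]]]
  by (simp add: delta_def)

definition delta_invariant :: "(charges \<Rightarrow> complex) \<Rightarrow> bool" where
  "delta_invariant F \<longleftrightarrow>
     (\<forall>\<xi> Z X. skew \<xi> \<longrightarrow> skew Z \<longrightarrow> delta \<xi> F (Z, X) = 0)"

definition A_mat :: "complex^6^6 \<Rightarrow> complex^6^6" where
  "A_mat Z = Z ** conj_mat Z"

definition I1 :: "charges \<Rightarrow> complex" where
  "I1 = (\<lambda>(Z, X). (trace (A_mat Z))\<^sup>2)"

definition I2 :: "charges \<Rightarrow> complex" where
  "I2 = (\<lambda>(Z, X). trace (A_mat Z ** A_mat Z))"

definition I3 :: "charges \<Rightarrow> complex" where
  "I3 = (\<lambda>(Z, X). complex_of_real (1 / (2^3 * fact 3) *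
     Re (\<Sum>a\<in>UNIV. \<Sum>b\<in>UNIV. \<Sum>c\<in>UNIV. \<Sum>d\<in>UNIV. \<Sum>e\<in>UNIV. \<Sum>f\<in>UNIV.
           eps a b c d e f * Z $ a $ b * Z $ c $ d * Z $ e $ f * X)))"

definition I4 :: "charges \<Rightarrow> complex" where
  "I4 = (\<lambda>(Z, X). trace (A_mat Z) * X * cnj X)"

definition I5 :: "charges \<Rightarrow> complex" where
  "I5 = (\<lambda>(Z, X). X\<^sup>2 * (cnj X)\<^sup>2)"

text \<open>\<open>S_sq\<close> is the quantity denoted \<open>S\<^sup>2\<close>; no \<open>S\<close> is involved.\<close>

definition S_sq :: "charges \<Rightarrow> complex" where
  "S_sq p = 1/4 * (4 * I2 p - I1 p + 32 * I3 p + 4 * I4 p + 4 * I5 p)"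

end

theory Submission
  imports Defs
begin

text \<open>
  Write \<open>U \<times> V\<close> for the antisymmetric matrix with entries
  \<open>1/4 \<epsilon>\<^sub>A\<^sub>B\<^sub>C\<^sub>D\<^sub>E\<^sub>F U\<^sup>C\<^sup>D V\<^sup>E\<^sup>F\<close> (the constant \<open>dual\<close> below). Then
  \<open>\<delta>Z = \<xi>* \<times> Z* + X* \<xi>\<close>, and \<open>tr (U (V \<times> W))\<close> is the polarized Pfaffian up to a factor, hence symmetric in
  \<open>U, V, W\<close>. Two identities for antisymmetric \<open>6 \<times> 6\<close> matrices carry the proof:
  \<open>x (y \<times> y) + 2 y (x \<times> y)\<close> is a scalar matrix (\<open>y \<times> y\<close> is the Pfaffian adjoint of
  \<open>y\<close> up to a factor; polarize), and \<open>(Z \<times> Z) \<times> y = 2 Z y Z - tr (Z y) Z\<close>. With them the variation of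
  every \<open>I\<^sub>k\<close> is a polynomial in \<open>X\<close>, in the traces \<open>tr (Z Z*)\<close>, \<open>tr (\<xi> Z*)\<close>,
  \<open>tr (\<xi> Z* Z Z*)\<close>, \<open>tr (\<xi> (Z \<times> Z))\<close>, \<open>tr (Z (Z \<times> Z))\<close>, and in their conjugates.
  In \<open>\<delta>(S\<^sup>2)\<close> these cancel; evaluating them at a few block diagonal \<open>Z\<close> forces the
  coefficients of an invariant combination to be proportional to those of \<open>S\<^sup>2\<close>.
\<close>

section \<open>The totally antisymmetric symbol\<close>

lemma UNIV_6_eq:
  assumes "distinct [a, b, c, d, e, f :: 6]"
  shows "UNIV = {a, b, c, d, e, f}"
proof -
  have "card {a, b, c, d, e, f} = CARD(6)"
    using assms by simp
  then show ?thesis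
    by (metis card_subset_eq finite subset_UNIV)
qed

lemma sum_6:
  fixes g :: "6 \<Rightarrow> 'a::comm_monoid_add"
  assumes "distinct [a, b, c, d, e, f :: 6]"
  shows "(\<Sum>i\<in>UNIV. g i) = g a + (g b + (g c + (g d + (g e + g f))))"
  using assms by (simp add: UNIV_6_eq[OF assms])

text \<open>The map inside \<open>eps\<close>, named so that its values at the six indices become
  rewrite rules.\<close>

definition upd6 :: "6 \<Rightarrow> 6 \<Rightarrow> 6 \<Rightarrow> 6 \<Rightarrow> 6 \<Rightarrow> 6 \<Rightarrow> 6 \<Rightarrow> 6" where
  "upd6 a b c d e f = id(1 := a, 2 := b, 3 := c, 4 := d, 5 := e, 6 := f)"

lemma upd6_simps [simp]:
  "upd6 a b c d e f 1 = a" "upd6 a b c d e f 2 = b" "upd6 a b c d e f 3 = c"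
  "upd6 a b c d e f 4 = d" "upd6 a b c d e f 5 = e" "upd6 a b c d e f 6 = f"
  by (simp_all add: upd6_def)

lemma all_6: "(\<forall>i::6. P i) \<longleftrightarrow> P 1 \<and> P 2 \<and> P 3 \<and> P 4 \<and> P 5 \<and> P 6"
proof -
  have "(\<forall>i::6. P i) \<longleftrightarrow> (\<forall>i\<in>{1,2,3,4,5,6}. P i)"
    using UNIV_6_eq[OF distinct_indices] by blast
  then show ?thesis by simp
qed

lemma eps_upd6: "eps a b c d e f =
    (if bij (upd6 a b c d e f) then of_int (sign (upd6 a b c d e f)) else 0)"
  by (simp add: eps_def upd6_def)

text \<open>Precomposition with a transposition flips the sign of a permutation and preserves
  failure of bijectivity.\<close>

lemma eps_transpose:
  assumes "upd6 a' b' c' d' e' f' = upd6 a b c d e f \<circ> Transposition.transpose i j" and "i \<noteq> j"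
  shows "eps a' b' c' d' e' f' = - eps a b c d e f"
proof (cases "bij (upd6 a b c d e f)")
  case True
  then have "bij (upd6 a b c d e f \<circ> Transposition.transpose i j)"
    by (intro bij_comp) auto
  moreover have "sign (upd6 a b c d e f \<circ> Transposition.transpose i j) = - sign (upd6 a b c d e f)"
    using True assms(2)
    by (subst sign_compose) (auto simp: permutation permutation_swap_id sign_swap_id)
  ultimately show ?thesis
    using True assms(1) by (simp add: eps_upd6)
next
  case False
  then have "\<not> bij (upd6 a b c d e f \<circ> Transposition.transpose i j)"
    by (simp add: bij_swap_iff)
  then show ?thesis
    using False assms(1) by (simp add: eps_upd6)
qed

lemmas upd6_eq_simps = fun_eq_iff all_6 Transposition.transpose_def

text \<open>The fifteen exchanges of two positions in lexicographic order, so that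
  \<open>eps_swap(13)\<close> exchanges positions 4 and 5. As rewrite rules they would loop, hence
  the instantiated uses below.\<close>

lemma eps_swap:
  "eps a b c d e f = - eps b a c d e f"
  "eps a b c d e f = - eps c b a d e f"
  "eps a b c d e f = - eps d b c a e f"
  "eps a b c d e f = - eps e b c d a f"
  "eps a b c d e f = - eps f b c d e a"
  "eps a b c d e f = - eps a c b d e f"
  "eps a b c d e f = - eps a d c b e f"
  "eps a b c d e f = - eps a e c d b f"
  "eps a b c d e f = - eps a f c d e b"
  "eps a b c d e f = - eps a b d c e f"
  "eps a b c d e f = - eps a b e d c f"
  "eps a b c d e f = - eps a b f d e c"
  "eps a b c d e f = - eps a b c e d f"
  "eps a b c d e f = - eps a b c f e d"
  "eps a b c d e f = - eps a b c d f e"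
  apply (rule eps_transpose[where i = 1 and j = 2]; simp add: upd6_eq_simps)
  apply (rule eps_transpose[where i = 1 and j = 3]; simp add: upd6_eq_simps)
  apply (rule eps_transpose[where i = 1 and j = 4]; simp add: upd6_eq_simps)
  apply (rule eps_transpose[where i = 1 and j = 5]; simp add: upd6_eq_simps)
  apply (rule eps_transpose[where i = 1 and j = 6]; simp add: upd6_eq_simps)
  apply (rule eps_transpose[where i = 2 and j = 3]; simp add: upd6_eq_simps)
  apply (rule eps_transpose[where i = 2 and j = 4]; simp add: upd6_eq_simps)
  apply (rule eps_transpose[where i = 2 and j = 5]; simp add: upd6_eq_simps)
  apply (rule eps_transpose[where i = 2 and j = 6]; simp add: upd6_eq_simps)
  apply (rule eps_transpose[where i = 3 and j = 4]; simp add: upd6_eq_simps)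
  apply (rule eps_transpose[where i = 3 and j = 5]; simp add: upd6_eq_simps)
  apply (rule eps_transpose[where i = 3 and j = 6]; simp add: upd6_eq_simps)
  apply (rule eps_transpose[where i = 4 and j = 5]; simp add: upd6_eq_simps)
  apply (rule eps_transpose[where i = 4 and j = 6]; simp add: upd6_eq_simps)
  apply (rule eps_transpose[where i = 5 and j = 6]; simp add: upd6_eq_simps)
  done

text \<open>Entrywise calculations keep the sign of one reference ordering undetermined; where two
  symbols meet, only this square matters.\<close>

lemma eps_square:
  assumes "distinct [a, b, c, d, e, f]"
  shows "eps a b c d e f * eps a b c d e f = 1"
proof -
  have "surj (upd6 a b c d e f)"
  proof -
    have "{a, b, c, d, e, f} \<subseteq> range (upd6 a b c d e f)"
      using rangeI[of "upd6 a b c d e f"] by (metis empty_subsetI insert_subset upd6_simps)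
    then show ?thesis
      using UNIV_6_eq[OF assms] by auto
  qed
  then have "bij (upd6 a b c d e f)"
    by (simp add: bij_def finite_UNIV_surj_inj)
  then show ?thesis
    by (simp add: eps_upd6 sign_def)
qed

lemma eps_eq_0:
  assumes "\<not> distinct [a, b, c, d, e, f]"
  shows "eps a b c d e f = 0"
proof -
  have "\<not> inj (upd6 a b c d e f)"
  proof
    assume "inj (upd6 a b c d e f)"
    then have "distinct (map (upd6 a b c d e f) [1, 2, 3, 4, 5, 6])"
      unfolding distinct_map using distinct_indices inj_on_subset by blast
    then show False using assms by simp
  qed
  then show ?thesis by (simp add: eps_upd6 bij_def)
qed

lemma bounded_bilinear_matrix_mult:
  "bounded_bilinear ((**) :: complex^6^6 \<Rightarrow> complex^6^6 \<Rightarrow> complex^6^6)"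
  unfolding bilinear_conv_bounded_bilinear[symmetric] bilinear_def
  by (auto intro!: linearI simp: vec_eq_iff matrix_matrix_mult_def algebra_simps
    sum.distrib scaleR_sum_right)

interpretation matrix_mult: bounded_bilinear "(**) :: complex^6^6 \<Rightarrow> complex^6^6 \<Rightarrow> complex^6^6"
  by (rule bounded_bilinear_matrix_mult)

section \<open>The product of antisymmetric matrices defined by the symbol\<close>

definition dual :: "complex^6^6 \<Rightarrow> complex^6^6 \<Rightarrow> complex^6^6" where
  "dual U V = (\<chi> a b. 1/4 * (\<Sum>c\<in>UNIV. \<Sum>d\<in>UNIV. \<Sum>e\<in>UNIV. \<Sum>f\<in>UNIV.
     eps a b c d e f * U $ c $ d * V $ e $ f))"

lemma skewD: "skew Z \<Longrightarrow> Z $ a $ b = - Z $ b $ a"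
  unfolding skew_def by blast

lemma skew_diag: "skew Z \<Longrightarrow> Z $ a $ a = 0"
  using skewD[of Z a a] by (simp add: eq_neg_iff_add_eq_0)

lemma skew_iff_transpose: "skew Z \<longleftrightarrow> transpose Z = - Z"
  unfolding skew_def transpose_def by (simp add: vec_eq_iff) (metis minus_minus)

text \<open>Only the index pairs \<open>(e, f)\<close> and \<open>(f, e)\<close> survive, and
  antisymmetry of both \<open>eps\<close> and \<open>V\<close> makes their contributions
  equal.\<close>

lemma eps_contract_pair:
  assumes "distinct [a, b, c, d, e, f]" and "skew V"
  shows "(\<Sum>i\<in>UNIV. \<Sum>j\<in>UNIV. eps a b c d i j * V $ i $ j) = 2 * eps a b c d e f * V $ e $ f"
  using assms(1)
  by (simp add: sum_6[OF assms(1)] eps_eq_0 eps_swap(15)[of a b c d f e] skewD[OF assms(2), of f e])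

lemma eps_contract_pair_eq_0:
  assumes "\<not> distinct [a, b, c, d]"
  shows "(\<Sum>i\<in>UNIV. \<Sum>j\<in>UNIV. eps a b c d i j * V $ i $ j) = 0"
proof -
  have "eps a b c d i j = 0" for i j
    using assms by (intro eps_eq_0) auto
  then show ?thesis by simp
qed

text \<open>Antisymmetry collapses the 24 nonzero terms to six, each occurring four times, which
  absorbs the factor \<open>1/4\<close>. The bracket is the polarized Pfaffian of the block with
  rows and columns \<open>c, d, e, f\<close>; for \<open>U = V\<close> it is twice that
  Pfaffian.\<close>

lemma dual_distinct:
  assumes "distinct [a, b, c, d, e, f]" and "skew U" "skew V"
  shows "dual U V $ a $ b = eps a b c d e f *
    (U $ c $ d * V $ e $ f - U $ c $ e * V $ d $ f + U $ c $ f * V $ d $ e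
     + U $ d $ e * V $ c $ f - U $ d $ f * V $ c $ e + U $ e $ f * V $ c $ d)"
proof -
  define E where "E i j = (\<Sum>k\<in>UNIV. \<Sum>l\<in>UNIV. eps a b i j k l * V $ k $ l)" for i j
  have dual_eq: "dual U V $ a $ b = 1/4 * (\<Sum>i\<in>UNIV. \<Sum>j\<in>UNIV. U $ i $ j * E i j)"
    unfolding dual_def E_def by (simp add: sum_distrib_left mult_ac)
  have E_0: "E i j = 0" if "\<not> distinct [a, b, i, j]" for i j
    unfolding E_def using eps_contract_pair_eq_0[OF that] .
  have E_swap: "E j i = - E i j" for i j
    unfolding E_def by (simp add: eps_swap(10)[of a b j i] sum_negf)
  have E_eps: "E c d = 2 * eps a b c d e f * V $ e $ f"
    "E c e = 2 * eps a b c e d f * V $ d $ f"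
    "E c f = 2 * eps a b c f d e * V $ d $ e"
    "E d e = 2 * eps a b d e c f * V $ c $ f"
    "E d f = 2 * eps a b d f c e * V $ c $ e"
    "E e f = 2 * eps a b e f c d * V $ c $ d"
    unfolding E_def by (rule eps_contract_pair; use assms in auto)+
  \<comment> \<open>Reordering \<open>c, d, e, f\<close> is even or odd; the signs are those of the
    Pfaffian expansion.\<close>
  have eps: "eps a b c e d f = - eps a b c d e f" "eps a b c f d e = eps a b c d e f"
    "eps a b d e c f = eps a b c d e f" "eps a b d f c e = - eps a b c d e f"
    "eps a b e f c d = eps a b c d e f"
    by (simp_all add: eps_swap(13)[of a b c e d f] eps_swap(13)[of a b c f d e]
        eps_swap(15)[of a b c d f e] eps_swap(13)[of a b d e c f] eps_swap(10)[of a b d c e f]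
        eps_swap(13)[of a b d f c e] eps_swap(10)[of a b d c f e]
        eps_swap(11)[of a b e f c d] eps_swap(14)[of a b c f e d])
  have E_vals: "E c d = 2 * eps a b c d e f * V $ e $ f"
    "E c e = - 2 * eps a b c d e f * V $ d $ f"
    "E c f = 2 * eps a b c d e f * V $ d $ e"
    "E d e = 2 * eps a b c d e f * V $ c $ f"
    "E d f = - 2 * eps a b c d e f * V $ c $ e"
    "E e f = 2 * eps a b c d e f * V $ c $ d"
    by (simp_all only: E_eps eps) simp_all
  have E_zeros: "E a x = 0" "E x a = 0" "E b x = 0" "E x b = 0" "E x x = 0" for x
    by (rule E_0; simp)+
  show ?thesis
    unfolding dual_eq
    by (simp add: sum_6[OF assms(1)] E_zeros E_swap[of d c] E_swap[of e c] E_swap[of f c]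
        E_swap[of e d] E_swap[of f d] E_swap[of f e] skewD[OF assms(2), of d c]
        skewD[OF assms(2), of e c] skewD[OF assms(2), of f c] skewD[OF assms(2), of e d]
        skewD[OF assms(2), of f d] skewD[OF assms(2), of f e] E_vals)
      (simp add: algebra_simps)
qed

lemma skew_dual: "skew (dual U V)"
proof -
  have "dual U V $ a $ b = - dual U V $ b $ a" for a b
    by (simp add: dual_def eps_swap(1)[of b a] sum_negf)
  then show ?thesis unfolding skew_def by blast
qed

lemma sum_swap_pairs:
  "(\<Sum>a\<in>A. \<Sum>b\<in>B. \<Sum>c\<in>C. \<Sum>d\<in>D. g a b c d) =
   (\<Sum>c\<in>C. \<Sum>d\<in>D. \<Sum>a\<in>A. \<Sum>b\<in>B. (g a b c d :: 'a::comm_monoid_add))"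
proof -
  have "(\<Sum>a\<in>A. \<Sum>b\<in>B. \<Sum>c\<in>C. \<Sum>d\<in>D. g a b c d) = (\<Sum>a\<in>A. \<Sum>c\<in>C. \<Sum>b\<in>B. \<Sum>d\<in>D. g a b c d)"
    by (intro sum.cong refl sum.swap)
  also have "\<dots> = (\<Sum>c\<in>C. \<Sum>a\<in>A. \<Sum>d\<in>D. \<Sum>b\<in>B. g a b c d)"
    by (subst sum.swap, intro sum.cong refl sum.swap)
  also have "\<dots> = (\<Sum>c\<in>C. \<Sum>d\<in>D. \<Sum>a\<in>A. \<Sum>b\<in>B. g a b c d)"
    by (intro sum.cong refl sum.swap)
  finally show ?thesis .
qed

text \<open>Exchanging two index pairs is a product of two transpositions, hence even.\<close>

lemma eps_pairs: "eps c d a b e f = eps a b c d e f" "eps a b e f c d = eps a b c d e f"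
  by (simp_all add: eps_swap(2)[of c d a b e f] eps_swap(7)[of a d c b e f]
      eps_swap(11)[of a b e f c d] eps_swap(14)[of a b c f e d])

lemma dual_commute: "dual U V = dual V U"
proof -
  have "dual U V $ a $ b = dual V U $ a $ b" for a b
    unfolding dual_def
    by (simp, subst sum_swap_pairs) (simp add: eps_pairs(2) mult_ac)
  then show ?thesis by (simp add: vec_eq_iff)
qed

text \<open>The trace pairs the entry of \<open>U\<close> at \<open>(a, b)\<close> with that of
  \<open>dual V W\<close> at \<open>(b, a)\<close>, which causes the minus sign.\<close>

lemma trace_mult_dual:
  "trace (U ** dual V W) = - 1/4 * (\<Sum>a\<in>UNIV. \<Sum>b\<in>UNIV. \<Sum>c\<in>UNIV. \<Sum>d\<in>UNIV. \<Sum>e\<in>UNIV. \<Sum>f\<in>UNIV.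
     eps a b c d e f * U $ a $ b * V $ c $ d * W $ e $ f)"
proof -
  have "trace (U ** dual V W) = (\<Sum>a\<in>UNIV. \<Sum>b\<in>UNIV. U $ a $ b * dual V W $ b $ a)"
    by (simp add: trace_def matrix_matrix_mult_def)
  also have "\<dots> = (\<Sum>a\<in>UNIV. \<Sum>b\<in>UNIV. - (U $ a $ b * dual V W $ a $ b))"
    by (intro sum.cong refl) (subst skewD[OF skew_dual], simp)
  also have "\<dots> = - (\<Sum>a\<in>UNIV. \<Sum>b\<in>UNIV. U $ a $ b * dual V W $ a $ b)"
    by (simp add: sum_negf)
  also have "\<dots> = - 1/4 * (\<Sum>a\<in>UNIV. \<Sum>b\<in>UNIV. \<Sum>c\<in>UNIV. \<Sum>d\<in>UNIV. \<Sum>e\<in>UNIV. \<Sum>f\<in>UNIV.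
     eps a b c d e f * U $ a $ b * V $ c $ d * W $ e $ f)"
    unfolding dual_def by (simp add: sum_distrib_left sum_divide_distrib sum_negf mult_ac)
  finally show ?thesis .
qed

text \<open>Together with \<open>dual_commute\<close> this makes the trilinear form symmetric in all
  three arguments.\<close>

lemma trace_mult_dual_commute: "trace (U ** dual V W) = trace (V ** dual U W)"
  unfolding trace_mult_dual
  by (subst sum_swap_pairs) (simp add: eps_pairs(1) mult_ac)

section \<open>Entrywise identities for antisymmetric 6 by 6 matrices\<close>

lemma matrix_mult_nth: "(A ** B) $ i $ j = (\<Sum>k\<in>UNIV. A $ i $ k * B $ k $ j)"
  by (simp add: matrix_matrix_mult_def)

text \<open>Generic labels for the remaining four indices replace a case distinction over all pairs
  \<open>(a, b)\<close>.\<close>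

lemma exists_distinct_6:
  assumes "a \<noteq> (b :: 6)"
  obtains c d e f where "distinct [a, b, c, d, e, f]"
proof -
  have "card (UNIV - {a, b}) = 4"
    using assms by (simp add: card_Diff_subset)
  then obtain xs where xs: "set xs = UNIV - {a, b}" "distinct xs" "length xs = 4"
    by (metis distinct_card finite_distinct_list finite)
  then obtain c d e f where "xs = [c, d, e, f]"
    by (auto simp: length_Suc_conv numeral_eq_Suc)
  with xs assms have "distinct [a, b, c, d, e, f]" by auto
  then show thesis ..
qed

text \<open>For \<open>x = y\<close> the entry is a multiple of a Pfaffian expansion in which row
  \<open>b\<close> has been replaced by row \<open>a\<close>, hence zero; the claim is the
  polarization of this.\<close>

lemma dual_mult_polarized_off_diag:
  assumes "skew x" "skew y" and "a \<noteq> b"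
  shows "(x ** dual y y + 2 *\<^sub>R (y ** dual x y)) $ a $ b = 0"
proof -
  obtain c d e f where D: "distinct [a, b, c, d, e, f]"
    using exists_distinct_6[OF assms(3)] .
  \<comment> \<open>In the matrix product the summation index \<open>k\<close> runs over
    \<open>c, d, e, f\<close>. Exchanging it with \<open>a\<close> in the reference order expresses
    every entry of \<open>dual\<close> through the one sign \<open>eps a b c d e f\<close>, leaving
    a polynomial identity.\<close>
  have P: "distinct [c, b, a, d, e, f]" "distinct [d, b, c, a, e, f]"
    "distinct [e, b, c, d, a, f]" "distinct [f, b, c, d, e, a]" using D by auto
  have S: "eps c b a d e f = - eps a b c d e f" "eps d b c a e f = - eps a b c d e f"
    "eps e b c d a f = - eps a b c d e f" "eps f b c d e a = - eps a b c d e f"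
    by (rule eps_swap)+
  show ?thesis
    by (simp add: matrix_mult_nth sum_6[OF D] skew_diag[OF skew_dual] skew_diag assms
        dual_distinct[OF P(1)] dual_distinct[OF P(2)] dual_distinct[OF P(3)] dual_distinct[OF P(4)] S
        skewD[of y c a] skewD[of y d a] skewD[of y e a] skewD[of y f a]
        skewD[of x c a] skewD[of x d a] skewD[of x e a] skewD[of x f a]
        skewD[of y d c] skewD[of y e c] skewD[of y f c] skewD[of y e d] skewD[of y f d] skewD[of y f e]
        skewD[of x d c] skewD[of x e c] skewD[of x f c] skewD[of x e d] skewD[of x f d] skewD[of x f e])
      (simp add: scaleR_conv_of_real algebra_simps)
qed

text \<open>Both sides are the same multiple of the polarized Pfaffian, expanded along row
  \<open>a\<close> and along row \<open>b\<close>.\<close>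

lemma dual_mult_polarized_diag:
  assumes "skew x" "skew y"
  shows "(x ** dual y y + 2 *\<^sub>R (y ** dual x y)) $ a $ a = (x ** dual y y + 2 *\<^sub>R (y ** dual x y)) $ b $ b"
proof (cases "a = b")
  case False
  obtain c d e f where D: "distinct [a, b, c, d, e, f]"
    using exists_distinct_6[OF False] .
  have P: "distinct [c, b, a, d, e, f]" "distinct [d, b, c, a, e, f]"
    "distinct [e, b, c, d, a, f]" "distinct [f, b, c, d, e, a]"
    "distinct [a, c, b, d, e, f]" "distinct [a, d, c, b, e, f]"
    "distinct [a, e, c, d, b, f]" "distinct [a, f, c, d, e, b]" using D by auto
  have S: "eps c b a d e f = - eps a b c d e f" "eps d b c a e f = - eps a b c d e f"
    "eps e b c d a f = - eps a b c d e f" "eps f b c d e a = - eps a b c d e f"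
     "eps a c b d e f = - eps a b c d e f" "eps a d c b e f = - eps a b c d e f"
    "eps a e c d b f = - eps a b c d e f" "eps a f c d e b = - eps a b c d e f"
    by (rule eps_swap)+
  note Q = skewD[OF skew_dual, of _ _ b a] skewD[OF skew_dual, of _ _ c a] skewD[OF skew_dual, of _ _ d a]
    skewD[OF skew_dual, of _ _ e a] skewD[OF skew_dual, of _ _ f a]
  show ?thesis
    by (simp add: matrix_mult_nth sum_6[OF D] skew_diag[OF skew_dual] skew_diag assms Q
        dual_distinct[OF D]
        dual_distinct[OF P(1)] dual_distinct[OF P(2)] dual_distinct[OF P(3)] dual_distinct[OF P(4)]
        dual_distinct[OF P(5)] dual_distinct[OF P(6)] dual_distinct[OF P(7)] dual_distinct[OF P(8)] S
        skewD[of y b a] skewD[of y c a] skewD[of y d a] skewD[of y e a] skewD[of y f a]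
        skewD[of x b a] skewD[of x c a] skewD[of x d a] skewD[of x e a] skewD[of x f a]
        skewD[of y c b] skewD[of y d b] skewD[of y e b] skewD[of y f b]
        skewD[of x c b] skewD[of x d b] skewD[of x e b] skewD[of x f b]
        skewD[of y d c] skewD[of y e c] skewD[of y f c] skewD[of y e d] skewD[of y f d] skewD[of y f e]
        skewD[of x d c] skewD[of x e c] skewD[of x f c] skewD[of x e d] skewD[of x f d] skewD[of x f e])
      (simp add: scaleR_conv_of_real algebra_simps)
qed simp

text \<open>Entries of \<open>dual Z Z\<close> are signed Pfaffians of 4 by 4 blocks of
  \<open>Z\<close>. In the outer product the inner and outer signs multiply to 1.\<close>

lemma dual_dual:
  assumes "skew Z" "skew y"
  shows "dual (dual Z Z) y $ a $ b = 2 * (Z ** y ** Z) $ a $ b - trace (Z ** y) * Z $ a $ b"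
proof (cases "a = b")
  case True
  \<comment> \<open>Both sides are antisymmetric, so they vanish on the diagonal.\<close>
  have "transpose (Z ** y ** Z) = - (Z ** y ** Z)"
    using assms by (simp add: skew_iff_transpose matrix_transpose_mul matrix_mul_assoc
        matrix_mult.minus_left matrix_mult.minus_right)
  then have "skew (Z ** y ** Z)"
    by (simp add: skew_iff_transpose)
  with True show ?thesis
    using assms by (simp add: skew_diag skew_dual)
next
  case False
  obtain c d e f where D: "distinct [a, b, c, d, e, f]"
    using exists_distinct_6[OF False] .
  have P: "distinct [c, d, a, b, e, f]" "distinct [c, e, a, d, b, f]" "distinct [c, f, a, d, e, b]"
    "distinct [d, e, c, a, b, f]" "distinct [d, f, c, a, e, b]" "distinct [e, f, c, d, a, b]"
    using D by auto
  \<comment> \<open>Each ordering arises by exchanging both \<open>a\<close> and \<open>b\<close>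
    with other indices, an even permutation.\<close>
  have S: "eps c d a b e f = eps a b c d e f" "eps c e a d b f = eps a b c d e f"
    "eps c f a d e b = eps a b c d e f" "eps d e c a b f = eps a b c d e f"
    "eps d f c a e b = eps a b c d e f" "eps e f c d a b = eps a b c d e f"
    by (simp_all add: eps_swap(7)[of c d a b e f] eps_swap(8)[of c e a d b f]
        eps_swap(9)[of c f a d e b] eps_swap(2)[of c b a d e f] eps_swap(8)[of d e c a b f]
        eps_swap(9)[of d f c a e b] eps_swap(3)[of d b c a e f] eps_swap(9)[of e f c d a b]
        eps_swap(4)[of e b c d a f])
  note sq = eps_square[OF D]
  have sq': "eps a b c d e f * (eps a b c d e f * w) = w" for w
    using sq by (simp flip: mult.assoc)
  show ?thesis
    unfolding dual_distinct[OF D skew_dual assms(2)]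
    by (simp add: matrix_mult_nth trace_def sum_6[OF D] skew_diag assms S
        dual_distinct[OF P(1)] dual_distinct[OF P(2)] dual_distinct[OF P(3)] dual_distinct[OF P(4)]
        dual_distinct[OF P(5)] dual_distinct[OF P(6)]
        skewD[of y b a] skewD[of y c a] skewD[of y d a] skewD[of y e a] skewD[of y f a]
        skewD[of Z b a] skewD[of Z c a] skewD[of Z d a] skewD[of Z e a] skewD[of Z f a]
        skewD[of y c b] skewD[of y d b] skewD[of y e b] skewD[of y f b]
        skewD[of Z c b] skewD[of Z d b] skewD[of Z e b] skewD[of Z f b]
        skewD[of y d c] skewD[of y e c] skewD[of y f c] skewD[of y e d] skewD[of y f d] skewD[of y f e]
        skewD[of Z d c] skewD[of Z e c] skewD[of Z f c] skewD[of Z e d] skewD[of Z f d] skewD[of Z f e])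
      (simp add: algebra_simps sq sq')
qed

section \<open>Linearity of the basic maps, and scalar matrices\<close>

lemma bounded_linear_trace: "bounded_linear (trace :: complex^6^6 \<Rightarrow> complex)"
  unfolding linear_conv_bounded_linear[symmetric]
  by (auto intro!: linearI simp: trace_def sum.distrib scaleR_sum_right)

lemma trace_scaleR: "trace (r *\<^sub>R A) = r *\<^sub>R trace (A :: complex^6^6)"
  by (simp add: trace_def scaleR_sum_right)

lemma bounded_linear_conj_mat: "bounded_linear conj_mat"
  unfolding linear_conv_bounded_linear[symmetric]
  by (auto intro!: linearI simp: conj_mat_def vec_eq_iff)

lemma bounded_bilinear_dual: "bounded_bilinear dual"
  unfolding bilinear_conv_bounded_bilinear[symmetric] bilinear_def
  by (auto intro!: linearI simp: vec_eq_iff dual_def algebra_simps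
    sum.distrib scaleR_sum_right)

interpretation dual: bounded_bilinear dual
  by (rule bounded_bilinear_dual)

lemma mat_mult_nth: "(mat k ** A) $ i $ j = k * A $ i $ j" for A :: "'a::semiring_1^'n^'n"
  by (simp add: matrix_matrix_mult_def mat_def if_distrib if_distribR sum.delta cong: if_cong)

lemma trace_mat_mult: "trace (mat k ** A) = k * trace A" for A :: "complex^6^6"
  by (simp add: trace_def mat_mult_nth sum_distrib_left)

lemma mult_mat_commute: "A ** mat k = mat k ** A" for A :: "complex^6^6"
  by (simp add: vec_eq_iff mat_mult_nth)
    (simp add: matrix_matrix_mult_def mat_def if_distrib if_distribR sum.delta mult.commute cong: if_cong)

text \<open>The entrywise lemmas show that the left side is scalar. Its trace is
  \<open>3 * trace (x ** dual y y)\<close> by symmetry of the trilinear form; division by 6 gives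
  the scalar.\<close>

lemma dual_mult_polarized:
  assumes "skew x" "skew y"
  shows "x ** dual y y + 2 *\<^sub>R (y ** dual x y) = mat (trace (x ** dual y y) / 2)"
proof -
  define M where "M = x ** dual y y + 2 *\<^sub>R (y ** dual x y)"
  have M: "M $ a $ b = (if a = b then M $ 1 $ 1 else 0)" for a b
    using dual_mult_polarized_off_diag[OF assms, of a b, folded M_def]
      dual_mult_polarized_diag[OF assms, of a 1, folded M_def]
    by auto
  have "trace M = (\<Sum>a\<in>(UNIV :: 6 set). M $ 1 $ 1)"
    unfolding trace_def by (intro sum.cong refl) (metis M)
  then have "6 * M $ 1 $ 1 = trace M" by simp
  also have "\<dots> = trace (x ** dual y y) + 2 * trace (y ** dual x y)"
    unfolding M_def trace_add trace_scaleR by (simp add: scaleR_conv_of_real)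
  also have "\<dots> = 3 * trace (x ** dual y y)"
    by (simp add: trace_mult_dual_commute[of y x y])
  finally have "M $ 1 $ 1 = trace (x ** dual y y) / 2"
    by (simp add: field_simps)
  then have "M $ a $ b = mat (trace (x ** dual y y) / 2) $ a $ b" for a b
    using M[of a b] by (simp add: mat_def)
  then show ?thesis
    unfolding M_def[symmetric] by (simp add: vec_eq_iff)
qed

text \<open>For \<open>x = y\<close> the left side of \<open>dual_mult_polarized\<close> is three
  copies of \<open>y ** dual y y\<close>.\<close>

lemma mult_dual_self:
  assumes "skew y"
  shows "y ** dual y y = mat (trace (y ** dual y y) / 6)"
proof -
  define k where "k = trace (y ** dual y y)"
  have "3 *\<^sub>R (y ** dual y y) = mat (k / 2)"
    using dual_mult_polarized[OF assms assms] scaleR_left.add[of 1 2 "y ** dual y y"]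
    by (simp add: k_def)
  then have "(3 *\<^sub>R (y ** dual y y)) $ a $ b = mat (k / 2) $ a $ b" for a b
    by simp
  then have "3 * (y ** dual y y) $ a $ b = 3 * mat (k / 6) $ a $ b" for a b
    by (simp add: scaleR_conv_of_real mat_def)
  then have "(y ** dual y y) $ a $ b = mat (k / 6) $ a $ b" for a b
    by (simp only: mult_cancel_left) simp
  then show ?thesis
    unfolding k_def[symmetric] by (simp add: vec_eq_iff)
qed

lemma dual_mult_self:
  assumes "skew y"
  shows "dual y y ** y = mat (trace (y ** dual y y) / 6)"
proof -
  have "dual y y ** y = transpose (y ** dual y y)"
    using assms skew_dual[of y y]
    by (simp add: matrix_transpose_mul skew_iff_transpose matrix_mult.minus_left matrix_mult.minus_right)
  also have "\<dots> = mat (trace (y ** dual y y) / 6)"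
    using mult_dual_self[OF assms] by (metis transpose_mat)
  finally show ?thesis .
qed

text \<open>The polarized identity is multiplied on the right by \<open>y ** Z\<close>; in its
  second term \<open>dual y y ** y\<close> is again scalar. This evaluates the part
  \<open>dual x y\<close> of \<open>delta_Z\<close> in the variation of \<open>I2\<close>.\<close>

lemma trace_dual_sandwich:
  assumes "skew x" "skew y"
  shows "trace (dual x y ** y ** Z ** y) =
    trace (x ** dual y y) * trace (Z ** y) / 4 - trace (y ** dual y y) * trace (x ** Z) / 12"
proof -
  have cyclic: "trace (dual x y ** y ** Z ** y) = trace (y ** dual x y ** (y ** Z))"
    by (subst trace_mul_sym) (simp add: matrix_mul_assoc)
  have "2 *\<^sub>R (y ** dual x y) = mat (trace (x ** dual y y) / 2) - x ** dual y y"
    using dual_mult_polarized[OF assms] by (simp add: algebra_simps)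
  then have "2 *\<^sub>R (y ** dual x y) ** (y ** Z) =
      mat (trace (x ** dual y y) / 2) ** (y ** Z) - x ** (dual y y ** y) ** Z"
    by (simp add: matrix_mult.diff_left) (simp add: matrix_mul_assoc)
  then have "trace (2 *\<^sub>R (y ** dual x y) ** (y ** Z)) =
      trace (x ** dual y y) / 2 * trace (y ** Z) - trace (x ** (dual y y ** y) ** Z)"
    by (simp only: trace_sub trace_mat_mult)
  moreover have "x ** (dual y y ** y) ** Z = mat (trace (y ** dual y y) / 6) ** (x ** Z)"
    unfolding dual_mult_self[OF assms(2)] mult_mat_commute matrix_mul_assoc ..
  ultimately have "2 * trace (y ** dual x y ** (y ** Z)) =
      trace (x ** dual y y) / 2 * trace (Z ** y) - trace (y ** dual y y) / 6 * trace (x ** Z)"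
    by (simp only: matrix_mult.scaleR_left trace_scaleR trace_mat_mult trace_mul_sym[of y Z])
      (simp add: scaleR_conv_of_real)
  with cyclic show ?thesis by (simp add: field_simps)
qed

text \<open>Symmetry of the trilinear form moves \<open>x\<close> out of the inner
  \<open>dual\<close>, and \<open>dual_dual\<close> applies. This serves the variation of
  \<open>I3\<close>.\<close>

lemma trace_dual_dual:
  assumes "skew Z" "skew y"
  shows "trace (dual x y ** dual Z Z) = 2 * trace (x ** Z ** y ** Z) - trace (Z ** y) * trace (x ** Z)"
proof -
  have "dual (dual Z Z) y = 2 *\<^sub>R (Z ** y ** Z) - mat (trace (Z ** y)) ** Z"
    using dual_dual[OF assms] by (simp add: vec_eq_iff mat_mult_nth scaleR_conv_of_real)
  moreover have "trace (dual x y ** dual Z Z) = trace (x ** dual (dual Z Z) y)"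
    by (subst trace_mul_sym) (simp add: trace_mult_dual_commute)
  moreover have "x ** (mat k ** Z) = mat k ** (x ** Z)" for k
    by (simp only: matrix_mul_assoc mult_mat_commute)
  ultimately show ?thesis
    by (simp only: matrix_mult.diff_right matrix_mult.scaleR_right trace_sub trace_scaleR trace_mat_mult)
      (simp add: scaleR_conv_of_real matrix_mul_assoc)
qed

section \<open>Complex conjugation of matrices and traces\<close>

lemma cnj_trace: "cnj (trace A) = trace (conj_mat A)" for A :: "complex^6^6"
  by (simp add: trace_def conj_mat_def)

lemma conj_mat_mult: "conj_mat (A ** B) = conj_mat A ** conj_mat B"
  by (simp add: conj_mat_def matrix_matrix_mult_def vec_eq_iff)

lemma conj_mat_conj_mat [simp]: "conj_mat (conj_mat A) = A"
  by (simp add: conj_mat_def vec_eq_iff)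

lemma skew_conj_mat:
  assumes "skew Z"
  shows "skew (conj_mat Z)"
proof -
  have "conj_mat Z $ a $ b = - conj_mat Z $ b $ a" for a b
    using skewD[OF assms, of a b] by (simp add: conj_mat_def)
  then show ?thesis
    unfolding skew_def by blast
qed

lemma cnj_eps: "cnj (eps a b c d e f) = eps a b c d e f"
  by (simp add: eps_def Let_def)

lemma conj_mat_dual: "conj_mat (dual U V) = dual (conj_mat U) (conj_mat V)"
  by (simp add: conj_mat_def dual_def vec_eq_iff cnj_eps)

section \<open>Variations of the invariants\<close>

text \<open>The complex multiple of \<open>\<xi>\<close> is a product with a scalar matrix, since
  \<open>scaleR\<close> covers real factors only.\<close>

lemma delta_Z_eq: "delta_Z \<xi> (Z, X) = dual (conj_mat \<xi>) (conj_mat Z) + mat (cnj X) ** \<xi>"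
  by (simp add: delta_Z_def dual_def vec_eq_iff mat_mult_nth mult.commute)

lemma delta_X_eq:
  assumes "skew Z"
  shows "delta_X \<xi> (Z, X) = - trace (\<xi> ** conj_mat Z) / 2"
proof -
  have "trace (\<xi> ** conj_mat Z) = (\<Sum>a\<in>UNIV. \<Sum>b\<in>UNIV. \<xi> $ a $ b * conj_mat Z $ b $ a)"
    by (simp add: trace_def matrix_matrix_mult_def)
  also have "\<dots> = (\<Sum>a\<in>UNIV. \<Sum>b\<in>UNIV. - (\<xi> $ a $ b * conj_mat Z $ a $ b))"
    by (intro sum.cong refl) (subst skewD[OF skew_conj_mat[OF assms]], simp)
  finally show ?thesis
    by (simp add: delta_X_def sum_negf)
qed

text \<open>The sixfold sum is \<open>-4\<close> times the trace term, and \<open>Re v\<close> is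
  half of \<open>v + cnj v\<close>; with \<open>2^3 * 3! = 48\<close> the factor is
  \<open>-1/24\<close>.\<close>

lemma I3_eq:
  "I3 (Z, X) = (-1/24) * (trace (Z ** dual Z Z) * X + cnj (trace (Z ** dual Z Z) * X))"
proof -
  have "(\<Sum>a\<in>UNIV. \<Sum>b\<in>UNIV. \<Sum>c\<in>UNIV. \<Sum>d\<in>UNIV. \<Sum>e\<in>UNIV. \<Sum>f\<in>UNIV.
           eps a b c d e f * Z $ a $ b * Z $ c $ d * Z $ e $ f * X) = - 4 * (trace (Z ** dual Z Z) * X)"
    by (simp add: trace_mult_dual sum_distrib_left sum_distrib_right mult_ac)
  then have "I3 (Z, X) = complex_of_real (1 / (2^3 * fact 3) * Re (- 4 * (trace (Z ** dual Z Z) * X)))"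
    unfolding I3_def by (simp only: prod.case)
  also have "complex_of_real (1 / (2^3 * fact 3) * Re (- 4 * v)) = (-1/24) * (v + cnj v)" for v
    by (simp add: complex_eq_iff fact_numeral)
  finally show ?thesis .
qed

text \<open>The derivative of \<open>trace (A_mat Z)\<close> at \<open>Z\<close> in direction
  \<open>W\<close>.\<close>

definition d_trA :: "complex^6^6 \<Rightarrow> complex^6^6 \<Rightarrow> complex" where
  "d_trA Z W = trace (W ** conj_mat Z) + cnj (trace (W ** conj_mat Z))"

lemma d_trA_eq: "trace (Z ** conj_mat W + W ** conj_mat Z) = d_trA Z W"
proof -
  have "cnj (trace (W ** conj_mat Z)) = trace (Z ** conj_mat W)"
    unfolding cnj_trace conj_mat_mult conj_mat_conj_mat by (rule trace_mul_sym)
  then show ?thesis by (simp add: d_trA_def trace_add)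
qed

section \<open>Real derivatives of the five invariants\<close>

lemmas has_derivative_trace = bounded_linear.has_derivative[OF bounded_linear_trace]
lemmas has_derivative_conj_mat = bounded_linear.has_derivative[OF bounded_linear_conj_mat]

context
  fixes Z :: "complex^6^6" and X :: complex
begin

text \<open>Derivatives are composed forward from the coordinates by the product rules, so that the
  derivative maps never need to be written out. \<open>D_Pf\<close> belongs to
  \<open>trace (Z ** dual Z Z) * X\<close>.\<close>

lemmas D_Z = bounded_linear_imp_has_derivative[OF bounded_linear_fst, of "at (Z, X)"]
lemmas D_X = bounded_linear_imp_has_derivative[OF bounded_linear_snd, of "at (Z, X)"]
lemmas D_A = matrix_mult.FDERIV[OF D_Z has_derivative_conj_mat[OF D_Z]]
lemmas D_tr = has_derivative_trace[OF D_A, simplified d_trA_eq fst_conv]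
lemmas D_XX = has_derivative_mult[OF D_X has_derivative_cnj[OF D_X]]
lemmas D_Pf = has_derivative_mult[OF has_derivative_trace[OF
  matrix_mult.FDERIV[OF D_Z dual.FDERIV[OF D_Z D_Z]]] D_X]

lemma I1_differentiable: "I1 differentiable (at (Z, X))"
  and delta_I1: "delta \<xi> I1 (Z, X) = 2 * trace (A_mat Z) * d_trA Z (delta_Z \<xi> (Z, X))"
proof -
  have "I1 = (\<lambda>p. trace (fst p ** conj_mat (fst p)) * trace (fst p ** conj_mat (fst p)))"
    by (simp add: I1_def A_mat_def fun_eq_iff power2_eq_square)
  note D = has_derivative_mult[OF D_tr D_tr, folded this]
  show "I1 differentiable (at (Z, X))"
    using D by (rule differentiableI)
  show "delta \<xi> I1 (Z, X) = 2 * trace (A_mat Z) * d_trA Z (delta_Z \<xi> (Z, X))"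
    using delta_eqI[OF D] by (simp add: A_mat_def)
qed

lemma I2_differentiable: "I2 differentiable (at (Z, X))"
  and delta_I2: "delta \<xi> I2 (Z, X) =
    2 * (trace (delta_Z \<xi> (Z, X) ** conj_mat Z ** Z ** conj_mat Z)
      + cnj (trace (delta_Z \<xi> (Z, X) ** conj_mat Z ** Z ** conj_mat Z)))"
proof -
  define W where "W = delta_Z \<xi> (Z, X)"
  have "I2 = (\<lambda>p. trace (fst p ** conj_mat (fst p) ** (fst p ** conj_mat (fst p))))"
    by (simp add: I2_def A_mat_def fun_eq_iff)
  note D = has_derivative_trace[OF matrix_mult.FDERIV[OF D_A D_A], folded this]
  show "I2 differentiable (at (Z, X))"
    using D by (rule differentiableI)
  have "delta \<xi> I2 (Z, X) = trace (A_mat Z ** (Z ** conj_mat W + W ** conj_mat Z)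
     + (Z ** conj_mat W + W ** conj_mat Z) ** A_mat Z)"
    using delta_eqI[OF D] by (simp add: A_mat_def W_def)
  \<comment> \<open>Cyclicity of the trace merges the four terms in pairs; the two resulting traces
    are complex conjugates.\<close>
  also have "\<dots> = 2 * trace (W ** conj_mat Z ** A_mat Z) + 2 * trace (Z ** conj_mat W ** A_mat Z)"
    by (simp only: matrix_mult.add_left matrix_mult.add_right trace_add
        trace_mul_sym[of "A_mat Z"]) simp
  also have "trace (Z ** conj_mat W ** A_mat Z) = cnj (trace (W ** conj_mat Z ** A_mat Z))"
    unfolding cnj_trace conj_mat_mult conj_mat_conj_mat A_mat_def
    by (metis trace_mul_sym matrix_mul_assoc)
  finally show "delta \<xi> I2 (Z, X) =
    2 * (trace (delta_Z \<xi> (Z, X) ** conj_mat Z ** Z ** conj_mat Z)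
      + cnj (trace (delta_Z \<xi> (Z, X) ** conj_mat Z ** Z ** conj_mat Z)))"
    by (simp add: A_mat_def matrix_mul_assoc W_def)
qed

text \<open>The variation of \<open>trace (Z ** dual Z Z) * X\<close>; the three slots of the
  symmetric trilinear form give the factor 3.\<close>

definition d_Pf :: "complex^6^6 \<Rightarrow> complex" where
  "d_Pf \<xi> = 3 * trace (delta_Z \<xi> (Z, X) ** dual Z Z) * X + trace (Z ** dual Z Z) * delta_X \<xi> (Z, X)"

lemma I3_differentiable: "I3 differentiable (at (Z, X))"
  and delta_I3: "delta \<xi> I3 (Z, X) = (-1/24) * (d_Pf \<xi> + cnj (d_Pf \<xi>))"
proof -
  define W where "W = delta_Z \<xi> (Z, X)"
  define w where "w = delta_X \<xi> (Z, X)"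
  have I3: "I3 = (\<lambda>p. (-1/24) * (trace (fst p ** dual (fst p) (fst p)) * snd p
      + cnj (trace (fst p ** dual (fst p) (fst p)) * snd p)))"
    by (simp add: fun_eq_iff I3_eq)
  note D = has_derivative_mult_right[OF has_derivative_add[OF D_Pf has_derivative_cnj[OF D_Pf]],
      of "-1/24", folded I3]
  show "I3 differentiable (at (Z, X))"
    using D by (rule differentiableI)
  have W: "trace (Z ** dual Z Z) * w + trace (Z ** (dual Z W + dual W Z) + W ** dual Z Z) * X = d_Pf \<xi>"
    unfolding d_Pf_def W_def[symmetric] w_def[symmetric] dual_commute[of Z W]
      matrix_mult.add_right trace_add trace_mult_dual_commute[of Z W Z]
    by (simp add: algebra_simps)
  show "delta \<xi> I3 (Z, X) = (-1/24) * (d_Pf \<xi> + cnj (d_Pf \<xi>))"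
    using delta_eqI[OF D, of \<xi>] unfolding fst_conv snd_conv W_def[symmetric] w_def[symmetric] W .
qed

lemma I4_differentiable: "I4 differentiable (at (Z, X))"
  and delta_I4: "delta \<xi> I4 (Z, X) = d_trA Z (delta_Z \<xi> (Z, X)) * X * cnj X
    + trace (A_mat Z) * (delta_X \<xi> (Z, X) * cnj X + X * cnj (delta_X \<xi> (Z, X)))"
proof -
  have "I4 = (\<lambda>p. trace (fst p ** conj_mat (fst p)) * (snd p * cnj (snd p)))"
    by (simp add: I4_def A_mat_def fun_eq_iff)
  note D = has_derivative_mult[OF D_tr D_XX, folded this]
  show "I4 differentiable (at (Z, X))"
    using D by (rule differentiableI)
  show "delta \<xi> I4 (Z, X) = d_trA Z (delta_Z \<xi> (Z, X)) * X * cnj X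
    + trace (A_mat Z) * (delta_X \<xi> (Z, X) * cnj X + X * cnj (delta_X \<xi> (Z, X)))"
    using delta_eqI[OF D] by (simp add: A_mat_def algebra_simps)
qed

lemma I5_differentiable: "I5 differentiable (at (Z, X))"
  and delta_I5: "delta \<xi> I5 (Z, X) =
    2 * X * cnj X * (delta_X \<xi> (Z, X) * cnj X + X * cnj (delta_X \<xi> (Z, X)))"
proof -
  have "I5 = (\<lambda>p. (snd p * cnj (snd p)) * (snd p * cnj (snd p)))"
    by (simp add: I5_def fun_eq_iff power2_eq_square)
  note D = has_derivative_mult[OF D_XX D_XX, folded this]
  show "I5 differentiable (at (Z, X))"
    using D by (rule differentiableI)
  show "delta \<xi> I5 (Z, X) =
    2 * X * cnj X * (delta_X \<xi> (Z, X) * cnj X + X * cnj (delta_X \<xi> (Z, X)))"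
    using delta_eqI[OF D] by (simp add: algebra_simps)
qed

lemmas I_differentiable =
  I1_differentiable I2_differentiable I3_differentiable I4_differentiable I5_differentiable

lemma delta_linear_combination:
  "delta \<xi> (\<lambda>p. c1 * I1 p + c2 * I2 p + c3 * I3 p + c4 * I4 p + c5 * I5 p) (Z, X) =
    c1 * delta \<xi> I1 (Z, X) + c2 * delta \<xi> I2 (Z, X) + c3 * delta \<xi> I3 (Z, X)
    + c4 * delta \<xi> I4 (Z, X) + c5 * delta \<xi> I5 (Z, X)"
proof -
  have "(\<lambda>p. c * F p) differentiable (at (Z, X))"
    "delta \<xi> (\<lambda>p. c * F p) (Z, X) = c * delta \<xi> F (Z, X)"
    if "F differentiable (at (Z, X))" for c :: complex and F
    using that by (simp_all add: delta_mult delta_const)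
  then show ?thesis
    by (simp add: delta_add I_differentiable)
qed

end

text \<open>\<open>delta_Z\<close> is traced against three matrices: \<open>y\<close>,
  \<open>y ** Z ** y\<close> and \<open>dual Z Z\<close> with \<open>y = conj_mat Z\<close>.
  Symmetry of the trilinear form, \<open>trace_dual_sandwich\<close> and
  \<open>trace_dual_dual\<close> evaluate these. Free coefficients let one formula serve both
  invariance and uniqueness.\<close>

lemma delta_linear_combination_skew:
  fixes \<xi> Z X
  assumes "skew \<xi>" "skew Z"
  defines "T \<equiv> trace (Z ** conj_mat Z)" and "a \<equiv> trace (\<xi> ** conj_mat Z)"
    and "b \<equiv> trace (\<xi> ** dual Z Z)" and "p \<equiv> trace (Z ** dual Z Z)"
    and "g \<equiv> trace (\<xi> ** conj_mat Z ** Z ** conj_mat Z)"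
  shows "delta \<xi> (\<lambda>p. c1 * I1 p + c2 * I2 p + c3 * I3 p + c4 * I4 p + c5 * I5 p) (Z, X) =
    2 * c1 * T * (b + cnj b + (cnj X * a + X * cnj a))
    + c2 * (T * (b + cnj b) / 2 - (p * a + cnj p * cnj a) / 6 + 2 * (cnj X * g + X * cnj g))
    - c3 / 24 * (6 * (cnj X * g + X * cnj g) - 3 * T * (cnj X * a + X * cnj a)
        + 3 * X * cnj X * (b + cnj b) - (p * a + cnj p * cnj a) / 2)
    + c4 * ((b + cnj b + (cnj X * a + X * cnj a)) * X * cnj X - T * (cnj X * a + X * cnj a) / 2)
    - c5 * X * cnj X * (cnj X * a + X * cnj a)"
proof -
  define x y where "x = conj_mat \<xi>" and "y = conj_mat Z"
  have xy: "skew x" "skew y"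
    using assms(1,2) by (simp_all add: x_def y_def skew_conj_mat)
  have conj: "cnj a = trace (x ** Z)" "cnj b = trace (x ** dual y y)"
    "cnj p = trace (y ** dual y y)" "cnj g = trace (x ** Z ** y ** Z)"
    by (simp_all add: a_def b_def p_def g_def x_def y_def cnj_trace conj_mat_mult conj_mat_dual)
  have T: "cnj T = T"
    by (simp add: T_def cnj_trace conj_mat_mult) (rule trace_mul_sym)
  have scalar: "mat k ** \<xi> ** M = mat k ** (\<xi> ** M)" for k M
    by (simp only: matrix_mul_assoc)
  have 1: "trace (delta_Z \<xi> (Z, X) ** y) = cnj b + cnj X * a"
    unfolding delta_Z_eq x_def[symmetric] y_def[symmetric] matrix_mult.add_left trace_add scalar
      trace_mat_mult conj trace_mult_dual_commute[of x y y] trace_mul_sym[of "dual x y" y]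
    by (simp add: a_def y_def)
  have 2: "trace (delta_Z \<xi> (Z, X) ** y ** Z ** y) = cnj b * T / 4 - cnj p * cnj a / 12 + cnj X * g"
    unfolding delta_Z_eq x_def[symmetric] y_def[symmetric] matrix_mult.add_left trace_add scalar
      trace_mat_mult trace_dual_sandwich[OF xy] conj
    by (simp add: T_def g_def y_def trace_mat_mult flip: matrix_mul_assoc)
  have 3: "trace (delta_Z \<xi> (Z, X) ** dual Z Z) = 2 * cnj g - T * cnj a + cnj X * b"
    unfolding delta_Z_eq x_def[symmetric] y_def[symmetric] matrix_mult.add_left trace_add scalar
      trace_mat_mult trace_dual_dual[OF assms(2) xy(2)] conj
    by (simp add: T_def b_def y_def)
  have 4: "delta_X \<xi> (Z, X) = - a / 2"
    using delta_X_eq[OF assms(2)] by (simp add: a_def)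
  show ?thesis
    unfolding delta_linear_combination delta_I1 delta_I2 delta_I3 delta_I4 delta_I5 d_trA_def d_Pf_def
      A_mat_def y_def[symmetric] 1 2 3 4 T_def[symmetric, folded y_def] p_def[symmetric]
    by (simp add: T) (simp add: algebra_simps diff_divide_distrib add_divide_distrib)
qed

section \<open>Invariance of \<open>S_sq\<close>\<close>

lemma S_sq_eq: "S_sq = (\<lambda>p. - 1/4 * I1 p + 1 * I2 p + 8 * I3 p + 1 * I4 p + 1 * I5 p)"
  by (simp add: S_sq_def fun_eq_iff)

text \<open>In the notation of \<open>delta_linear_combination_skew\<close>, the six coefficients
  \<open>2 c1 + c2/2\<close> of \<open>T b\<close>, \<open>c3/48 - c2/6\<close> of
  \<open>p a\<close>, \<open>2 c2 - c3/4\<close> of \<open>cnj X g\<close>,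
  \<open>2 c1 + c3/8 - c4/2\<close> of \<open>T cnj X a\<close>, \<open>c4 - c3/8\<close> of
  \<open>X cnj X b\<close> and \<open>c4 - c5\<close> of \<open>X cnj X cnj X a\<close> all
  vanish.\<close>

lemma delta_invariant_S_sq: "delta_invariant S_sq"
  unfolding delta_invariant_def S_sq_eq
proof (intro allI impI)
  fix \<xi> Z X
  assume "skew \<xi>" "skew Z"
  then show "delta \<xi> (\<lambda>p. - 1/4 * I1 p + 1 * I2 p + 8 * I3 p + 1 * I4 p + 1 * I5 p) (Z, X) = 0"
    by (simp only: delta_linear_combination_skew)
      (simp add: algebra_simps add_divide_distrib diff_divide_distrib)
qed

section \<open>Block diagonal charges\<close>

text \<open>The shape of the normal form of an antisymmetric matrix under unitary
  congruence.\<close>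

definition block :: "complex \<Rightarrow> complex \<Rightarrow> complex \<Rightarrow> complex^6^6" where
  "block u v w = (\<chi> a b.
     if (a, b) = (1, 2) then u else if (a, b) = (2, 1) then - u
     else if (a, b) = (3, 4) then v else if (a, b) = (4, 3) then - v
     else if (a, b) = (5, 6) then w else if (a, b) = (6, 5) then - w else 0)"

lemma skew_block: "skew (block u v w)"
  by (auto simp: skew_def block_def)

lemma conj_mat_block: "conj_mat (block u v w) = block (cnj u) (cnj v) (cnj w)"
  by (simp add: conj_mat_def block_def vec_eq_iff)

lemmas sum_UNIV_6 = sum_6[OF distinct_indices]

lemma trace_block_mult:
  "trace (block u v w ** M) = u * (M $ 2 $ 1 - M $ 1 $ 2) + v * (M $ 4 $ 3 - M $ 3 $ 4)
     + w * (M $ 6 $ 5 - M $ 5 $ 6)"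
  by (simp add: trace_def matrix_mult_nth sum_UNIV_6 block_def algebra_simps)

lemma trace_block_block: "trace (block u v w ** block u' v' w') = - 2 * (u * u' + v * v' + w * w')"
  by (simp add: trace_block_mult) (simp add: block_def algebra_simps)

lemma trace_block_4:
  "trace (block u v w ** block u1 v1 w1 ** block u2 v2 w2 ** block u3 v3 w3) =
    2 * (u * u1 * u2 * u3 + v * v1 * v2 * v3 + w * w1 * w2 * w3)"
  unfolding matrix_mul_assoc[symmetric] trace_block_mult
  by (simp add: matrix_mult_nth sum_UNIV_6) (simp add: block_def algebra_simps)

text \<open>Only the first block of the left factor is nonzero, so a single entry of
  \<open>dual\<close> matters: twice the Pfaffian \<open>v * w\<close> of the complementary
  block.\<close>

lemma trace_block_dual:
  "trace (block u 0 0 ** dual (block u' v w) (block u' v w)) = - 4 * u * v * w"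
proof -
  have "dual (block u' v w) (block u' v w) $ 1 $ 2 = 2 * v * w"
    by (simp add: dual_distinct[OF distinct_indices skew_block skew_block] eps_123456)
      (simp add: block_def)
  then show ?thesis
    by (simp add: trace_block_mult skewD[OF skew_dual, of _ _ 2 1])
qed

lemma invariant_coefficients:
  assumes "delta_invariant (\<lambda>p. c1 * I1 p + c2 * I2 p + c3 * I3 p + c4 * I4 p + c5 * I5 p)"
  shows "c1 = - c4 / 4" "c2 = c4" "c3 = 8 * c4" "c5 = c4"
proof -
  have inv: "delta (block 1 0 0) (\<lambda>p. c1 * I1 p + c2 * I2 p + c3 * I3 p + c4 * I4 p + c5 * I5 p)
      (block u v w, X) = 0" for u v w X
    using assms skew_block by (simp add: delta_invariant_def)
  note eq = inv[unfolded delta_linear_combination_skew[OF skew_block skew_block] conj_mat_block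
      trace_block_block trace_block_4 trace_block_dual]
  \<comment> \<open>With \<open>\<xi> = block 1 0 0\<close> and \<open>Z = block 0 1 1\<close> the
    traces \<open>a\<close> and \<open>g\<close> vanish, while \<open>T = b = -4\<close>. At
    \<open>X = 0\<close> only \<open>I1\<close> and \<open>I2\<close> contribute;
    \<open>X = 1\<close> then relates \<open>I3\<close> to \<open>I4\<close>.\<close>
  have e1: "c2 = - 4 * c1"
    using eq[of 0 1 1 0] by (simp add: trace_block_dual) algebra
  have e2: "c3 = 8 * c4"
    using eq[of 0 1 1 1] by (simp add: e1 algebra_simps)
  \<comment> \<open>For \<open>Z = \<xi>\<close> the traces \<open>b\<close> and \<open>p\<close>
    vanish and the terms with \<open>c3\<close> cancel. Real nonzero \<open>X\<close> gives
    \<open>4 c1 + 2 c2 = c4 + X^2 (c4 - c5)\<close>; the values 1 and 2 separate the two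
    parts.\<close>
  have e3: "4 * c1 + 2 * c2 = c4 + (c4 - c5)"
    using eq[of 1 0 0 1] by (simp add: trace_block_dual) algebra
  have e4: "4 * c1 + 2 * c2 = c4 + 4 * (c4 - c5)"
    using eq[of 1 0 0 2] by (simp add: trace_block_dual) algebra
  show "c5 = c4"
    using e3 e4 by algebra
  then have e5: "c4 = - 4 * c1"
    using e1 e3 by (simp add: algebra_simps)
  show "c2 = c4"
    using e1 e5 by simp
  show "c1 = - c4 / 4"
    using e5 by simp
  show "c3 = 8 * c4"
    by (rule e2)
qed

theorem mainTheorem6:
  shows "delta_invariant S_sq \<and>
    (\<forall>c1 c2 c3 c4 c5 :: complex.
       delta_invariant (\<lambda>p. c1 * I1 p + c2 * I2 p + c3 * I3 p + c4 * I4 p + c5 * I5 p) \<longrightarrow>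
       (\<exists>k :: complex. \<forall>Z X. skew Z \<longrightarrow>
          c1 * I1 (Z, X) + c2 * I2 (Z, X) + c3 * I3 (Z, X) + c4 * I4 (Z, X) + c5 * I5 (Z, X)
            = k * S_sq (Z, X)))"
proof (intro conjI allI impI)
  show "delta_invariant S_sq"
    by (rule delta_invariant_S_sq)
  fix c1 c2 c3 c4 c5 :: complex
  assume "delta_invariant (\<lambda>p. c1 * I1 p + c2 * I2 p + c3 * I3 p + c4 * I4 p + c5 * I5 p)"
  note c = invariant_coefficients[OF this]
  \<comment> \<open>The witness is \<open>c4\<close>, because \<open>I4\<close> enters
    \<open>S_sq\<close> with coefficient 1.\<close>
  have "c1 * I1 (Z, X) + c2 * I2 (Z, X) + c3 * I3 (Z, X) + c4 * I4 (Z, X) + c5 * I5 (Z, X)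
      = c4 * S_sq (Z, X)" for Z X
    by (simp add: c S_sq_def algebra_simps)
  then show "\<exists>k. \<forall>Z X. skew Z \<longrightarrow>
      c1 * I1 (Z, X) + c2 * I2 (Z, X) + c3 * I3 (Z, X) + c4 * I4 (Z, X) + c5 * I5 (Z, X)
        = k * S_sq (Z, X)"
    by blast
qed

end
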